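(* Let $Z\ge 2$ be the number of classes, and suppose the labels of a $Z$-class classification problem are corrupted by symmetric (uniform) label noise with noise rate $\eta\in[0,1]$ satisfying $\eta<\frac{Z-1}{Z}$. Let $x_1<0$ and $x_2\in\mathbb{R}$ be the hyper-parameters of the NFL loss and the EL loss respectively. Let $L_\ast$ be either $L_{\mathrm{NFL}}$ or $L_{\mathrm{EL}}$, let $t=x_1$ if $L_\ast=L_{\mathrm{NFL}}$ and $t=x_2$ if $L_\ast=L_{\mathrm{EL}}$, and let $L(F(\mathbf{x}),\mathbf{q})=L_\ast(\|\mathbf{q}-F(\mathbf{x})\|_1)$ be the induced classification loss. Let $\mathcal{F}$ be any set of (measurable) softmax-output classifiers $F$ such that the loss input always exceeds $t$, i.e. $\|\mathbf{q}_j-F(\mathbf{x})\|_1>t$ for every $F\in\mathcal{F}$, every input $\mathbf{x}$ and every $j\in\{1,\dots,Z\}$. Then $L$ is noise-tolerant: the minimizers over $\mathcal{F}$ of the noisy risk $R_L^{\eta}$ are the same as the minimizers over $\mathcal{F}$ of the noise-free risk $R_L$; that is, $F^*\in\mathcal{F}$ satisfies $R_L(F^* )\le R_L(F)$ for all $F\in\mathcal{F}$ if and only if $R_L^{\eta}(F^* )\le R_L^{\eta}(F)$ for all $F\in\mathcal{F}$.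
   Context: Loss functions on $\mathbb{R}$. For $x_1<0$, the negative fraction linear (NFL) loss is $L_{\mathrm{NFL}}(x)=\frac{1}{x_1^2}x-\frac{1}{x_1}$ if... the printed definition: $L_{\mathrm{NFL}}(x)=\frac{1}{x_1^{2}}x-\frac{1}{x_1}$ for $x\ge x_1$, and $L_{\mathrm{NFL}}(x)=-\frac{1}{x}$ for $x<x_1$. For $x_2\in\mathbb{R}$, the exponential linear (EL) loss is $L_{\mathrm{EL}}(x)=e^{x_2}(x+1-x_2)$ for $x\ge x_2$, and $L_{\mathrm{EL}}(x)=e^{x}$ for $x<x_2$. Classification setting. A random pair $(\mathbf{x},y_{\mathbf{x}})$ consists of an input $\mathbf{x}$ and its true label $y_{\mathbf{x}}\in\{\mathbf{q}_1,\dots,\mathbf{q}_Z\}$, where $\mathbf{q}_c\in\mathbb{R}^Z$ is the one-hot vector with entry $1$ in position $c$ and $0$ elsewhere. A softmax-output classifier is a map $F$ with $F(\mathbf{x})=\mathbf{u}=[u_1,\dots,u_Z]$, $u_z=\exp(G(\mathbf{x})_z)/\sum_{z'=1}^{Z}\exp(G(\mathbf{x})_{z'})$ for some $\mathbb{R}^Z$-valued function $G$; in particular $u_z>0$ and $\sum_z u_z=1$. The residual (the loss input) of $F$ at $\mathbf{x}$ with respect to a label $\mathbf{q}$ is the absolute error $\|\mathbf{q}-F(\mathbf{x})\|_1$ (the sum of absolute values of the entries). Symmetric (uniform) label noise with rate $\eta$. Conditionally on $\mathbf{x}$ and $y_{\mathbf{x}}=\mathbf{q}_c$, the noisy label $\hat{y}_{\mathbf{x}}$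 equals $\mathbf{q}_c$ with probability $1-\eta$ and equals $\mathbf{q}_j$ with probability $\frac{\eta}{Z-1}$ for each $j\ne c$. Risks. $R_L(F)=\mathbb{E}_{\mathbf{x},y_{\mathbf{x}}}[L(F(\mathbf{x}),y_{\mathbf{x}})]$ and $R_L^{\eta}(F)=\mathbb{E}_{\mathbf{x},\hat{y}_{\mathbf{x}}}[L(F(\mathbf{x}),\hat{y}_{\mathbf{x}})]$. A loss is called noise-tolerant if the minimizer of the risk with noisy labels is the same as the minimizer of the risk with noise-free labels. *)

theory Defs
  imports "HOL-Probability.Probability"
begin

text \<open>
  The linear branch is not the tangent to \<open>- 1 / x\<close> at \<open>x1\<close> (whose constant term is \<open>- 2 / x1\<close>):
  the loss jumps at \<open>x1\<close>.
\<close>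

definition nfl_loss :: "real \<Rightarrow> real \<Rightarrow> real" where
  "nfl_loss x1 x = (if x \<ge> x1 then 1 / x1\<^sup>2 * x - 1 / x1 else - 1 / x)"

definition el_loss :: "real \<Rightarrow> real \<Rightarrow> real" where
  "el_loss x2 x = (if x \<ge> x2 then exp x2 * (x + 1 - x2) else exp x)"

text \<open>The number of classes is \<open>CARD('z)\<close>; the type \<open>'z\<close> indexes the classes.\<close>

definition one_hot :: "'z::finite \<Rightarrow> real ^ 'z" where
  "one_hot c = (\<chi> i. if i = c then 1 else 0)"

definition softmax :: "real ^ 'z::finite \<Rightarrow> real ^ 'z" where
  "softmax g = (\<chi> i. exp (g $ i) / (\<Sum>j\<in>UNIV. exp (g $ j)))"

definition l1_norm :: "real ^ 'z::finite \<Rightarrow> real" where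
  "l1_norm v = (\<Sum>i\<in>UNIV. \<bar>v $ i\<bar>)"

text \<open>Inputs range over the measurable space \<open>N\<close> and play no role outside \<open>space N\<close>.\<close>

definition softmax_classifier :: "'a measure \<Rightarrow> ('a \<Rightarrow> real ^ 'z::finite) \<Rightarrow> bool" where
  "softmax_classifier N F \<longleftrightarrow>
     F \<in> borel_measurable N \<and> (\<exists>G. \<forall>x\<in>space N. F x = softmax (G x))"

definition residual_loss ::
    "(real \<Rightarrow> real) \<Rightarrow> real ^ 'z::finite \<Rightarrow> real ^ 'z \<Rightarrow> real" where
  "residual_loss l u q = l (l1_norm (q - u))"

definition random_label :: "'w measure \<Rightarrow> ('w \<Rightarrow> real ^ 'z::finite) \<Rightarrow> bool" where
  "random_label M Y \<longleftrightarrow> Y \<in> borel_measurable M \<and> Y ` space M \<subseteq> range one_hot"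

text \<open>
  The conditional probability of \<open>Yn = one_hot j\<close> given the pair \<open>(X, Y)\<close> is the conditional
  expectation of the indicator with respect to the sigma-algebra generated by that pair.
\<close>

definition symmetric_label_noise ::
    "'w measure \<Rightarrow> 'a measure \<Rightarrow> real \<Rightarrow> ('w \<Rightarrow> 'a) \<Rightarrow> ('w \<Rightarrow> real ^ 'z::finite) \<Rightarrow>
     ('w \<Rightarrow> real ^ 'z) \<Rightarrow> bool" where
  "symmetric_label_noise M N \<eta> X Y Yn \<longleftrightarrow>
     (\<forall>c j. AE \<omega> in M. Y \<omega> = one_hot c \<longrightarrow>
        real_cond_exp M (vimage_algebra (space M) (\<lambda>\<omega>. (X \<omega>, Y \<omega>)) (N \<Otimes>\<^sub>M borel))
          (indicator {\<omega> \<in> space M. Yn \<omega> = one_hot j}) \<omega>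
        = (if j = c then 1 - \<eta> else \<eta> / (real CARD('z) - 1)))"

text \<open>The same functional is the noise-free or the noisy risk, depending on the label \<open>Y\<close>.\<close>

definition risk ::
    "'w measure \<Rightarrow> (real ^ 'z::finite \<Rightarrow> real ^ 'z \<Rightarrow> real) \<Rightarrow> ('w \<Rightarrow> 'a) \<Rightarrow>
     ('w \<Rightarrow> real ^ 'z) \<Rightarrow> ('a \<Rightarrow> real ^ 'z) \<Rightarrow> real" where
  "risk M L X Y F = (\<integral>\<omega>. L (F (X \<omega>)) (Y \<omega>) \<partial>M)"

definition minimizers :: "'f set \<Rightarrow> ('f \<Rightarrow> real) \<Rightarrow> 'f set" where
  "minimizers \<F> R = {F \<in> \<F>. \<forall>F'\<in>\<F>. R F \<le> R F'}"

definition noise_tolerant ::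
    "'w measure \<Rightarrow> ('w \<Rightarrow> 'a) \<Rightarrow> ('w \<Rightarrow> real ^ 'z::finite) \<Rightarrow> ('w \<Rightarrow> real ^ 'z) \<Rightarrow>
     ('a \<Rightarrow> real ^ 'z) set \<Rightarrow> (real ^ 'z \<Rightarrow> real ^ 'z \<Rightarrow> real) \<Rightarrow> bool" where
  "noise_tolerant M X Y Yn \<F> L \<longleftrightarrow>
     minimizers \<F> (risk M L X Yn) = minimizers \<F> (risk M L X Y)"

end

theory Submission
  imports Defs
begin

text \<open>
  On \<open>{t..}\<close> the loss is affine with positive slope, and the residual of a probability vector \<open>u\<close>
  at the label \<open>c\<close> is \<open>2 - 2 * u $ c\<close>. Hence the losses of a softmax output at the \<open>Z\<close> possible
  labels add up to a constant, so that averaging over the noise gives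
  \<open>R\<^sup>\<eta> = (1 - \<eta> * Z / (Z - 1)) * R + const\<close>, an increasing affine function of the noise-free risk.
\<close>

lemma one_hot_eq_iff: "one_hot c = one_hot d \<longleftrightarrow> c = d"
proof
  assume "one_hot c = one_hot d"
  then have "one_hot c $ c = one_hot d $ c" by simp
  then show "c = d" by (auto simp: one_hot_def split: if_splits)
qed simp

lemma softmax_nonneg: "0 \<le> softmax g $ i"
  by (simp add: softmax_def sum_nonneg)

lemma sum_softmax: "(\<Sum>i\<in>UNIV. softmax g $ i) = 1"
proof -
  have "(\<Sum>j\<in>UNIV. exp (g $ j)) > 0" by (rule sum_pos) auto
  then show ?thesis by (simp add: softmax_def flip: sum_divide_distrib)
qed

text \<open>Entry \<open>c\<close> contributes \<open>1 - u $ c\<close>, which is nonnegative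
  because the other entries are; those other entries contribute their total mass, which is again
  \<open>1 - u $ c\<close>.\<close>

lemma l1_norm_one_hot_diff:
  assumes nn: "\<And>i. 0 \<le> u $ i" and sum1: "(\<Sum>i\<in>UNIV. u $ i) = 1"
  shows "l1_norm (one_hot c - u) = 2 - 2 * u $ c"
proof -
  have split: "(\<Sum>i\<in>UNIV. u $ i) = u $ c + (\<Sum>i\<in>UNIV - {c}. u $ i)"
    by (rule sum.remove) auto
  moreover have "0 \<le> (\<Sum>i\<in>UNIV - {c}. u $ i)" using nn by (simp add: sum_nonneg)
  ultimately have le1: "u $ c \<le> 1" using sum1 by simp
  have "l1_norm (one_hot c - u)
      = \<bar>1 - u $ c\<bar> + (\<Sum>i\<in>UNIV - {c}. \<bar>one_hot c $ i - u $ i\<bar>)"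
    unfolding l1_norm_def by (subst sum.remove[of _ c]) (auto simp: one_hot_def)
  also have "(\<Sum>i\<in>UNIV - {c}. \<bar>one_hot c $ i - u $ i\<bar>) = (\<Sum>i\<in>UNIV - {c}. u $ i)"
    using nn by (intro sum.cong) (auto simp: one_hot_def)
  finally show ?thesis using split sum1 le1 by simp
qed

text \<open>An increasing affine map preserves and reflects the order of the risks. In the theorem
  \<open>R'\<close> is the noisy risk, \<open>R\<close> the noise-free one, and the bound on the
  noise rate gives \<open>0 < k\<close>.\<close>

lemma minimizers_affine:
  fixes R R' :: "'f \<Rightarrow> real"
  assumes "0 < k" and "\<And>F. F \<in> \<F> \<Longrightarrow> R' F = k * R F + m"
  shows "minimizers \<F> R' = minimizers \<F> R"
  using assms by (auto simp: minimizers_def)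

text \<open>The function \<open>f j\<close> is to be thought of as the loss at the label \<open>one_hot j\<close>.\<close>

lemma expectation_symmetric_label_noise:
  fixes Y Yn :: "'w \<Rightarrow> real ^ 'z::finite" and f :: "'z \<Rightarrow> 'a \<Rightarrow> real"
  assumes "prob_space M" and X: "X \<in> measurable M N"
    and Y: "random_label M Y" and Yn: "random_label M Yn"
    and noise: "symmetric_label_noise M N \<eta> X Y Yn"
    and f: "\<And>j. f j \<in> borel_measurable N"
    and bound: "\<And>j x. x \<in> space N \<Longrightarrow> \<bar>f j x\<bar> \<le> B"
    and const: "\<And>x. x \<in> space N \<Longrightarrow> (\<Sum>j\<in>UNIV. f j x) = C"
  defines "\<beta> \<equiv> \<eta> / (real CARD('z) - 1)"
  shows "(\<integral>\<omega>. (\<Sum>j\<in>UNIV. f j (X \<omega>) * indicator {\<omega> \<in> space M. Yn \<omega> = one_hot j} \<omega>) \<partial>M)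
    = (1 - \<eta> - \<beta>) *
      (\<integral>\<omega>. (\<Sum>j\<in>UNIV. f j (X \<omega>) * indicator {\<omega> \<in> space M. Y \<omega> = one_hot j} \<omega>) \<partial>M) + \<beta> * C"
proof -
  interpret prob_space M by fact
  define G where "G = vimage_algebra (space M) (\<lambda>\<omega>. (X \<omega>, Y \<omega>)) (N \<Otimes>\<^sub>M (borel :: (real ^ 'z) measure))"
  note [measurable] = X f
  have [measurable]: "Y \<in> borel_measurable M" "Yn \<in> borel_measurable M"
    using Y Yn by (auto simp: random_label_def)
  have pair: "(\<lambda>\<omega>. (X \<omega>, Y \<omega>)) \<in> measurable M (N \<Otimes>\<^sub>M borel)" by measurable
  have "subalgebra M G"
    using sets_image_in_sets[OF refl pair] by (simp add: subalgebra_def G_def)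
  then interpret finite_measure_subalgebra M G by unfold_locales
  have "(\<lambda>\<omega>. (X \<omega>, Y \<omega>)) \<in> measurable G (N \<Otimes>\<^sub>M borel)"
    unfolding G_def by (rule measurable_vimage_algebra1) (use measurable_space[OF pair] in blast)
  then have "(\<lambda>\<omega>. fst (X \<omega>, Y \<omega>)) \<in> measurable G N"
    by (rule measurable_compose[OF _ measurable_fst])
  \<comment> \<open>Since \<open>X\<close> is measurable for \<open>G\<close>, each
    \<open>f j (X \<omega>)\<close> can be moved in and out of conditional expectations given
    \<open>G\<close>.\<close>
  then have XG: "X \<in> measurable G N" by simp
  \<comment> \<open>The factor \<open>h\<close> is instantiated with the indicators of both labels
    and with the constant 1.\<close>
  have int: "integrable M (\<lambda>\<omega>. f j (X \<omega>) * h \<omega>)"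
    if h[measurable]: "h \<in> borel_measurable M" and h1: "\<And>\<omega>. \<bar>h \<omega>\<bar> \<le> 1" for j and h :: "'w \<Rightarrow> real"
  proof (rule integrable_const_bound[where B = B])
    have "\<bar>f j (X \<omega>)\<bar> * \<bar>h \<omega>\<bar> \<le> B * 1" if "\<omega> \<in> space M" for \<omega>
      using bound[of "X \<omega>" j] h1[of \<omega>] measurable_space[OF X that] by (intro mult_mono) auto
    then show "AE \<omega> in M. norm (f j (X \<omega>) * h \<omega>) \<le> B" by (auto simp: abs_mult)
  qed measurable
  let ?I = "\<lambda>Y j. indicator {\<omega> \<in> space M. Y \<omega> = one_hot j} :: 'w \<Rightarrow> real"
  have intI: "integrable M (\<lambda>\<omega>. f j (X \<omega>) * ?I Y j \<omega>)" "integrable M (\<lambda>\<omega>. f j (X \<omega>) * ?I Yn j \<omega>)"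
      "integrable M (\<lambda>\<omega>. f j (X \<omega>))" for j
    using int[of "?I Y j" j] int[of "?I Yn j" j] int[of "\<lambda>_. 1" j] by (auto simp: indicator_def)
  have noisy_term: "(\<integral>\<omega>. f j (X \<omega>) * ?I Yn j \<omega> \<partial>M)
      = (1 - \<eta> - \<beta>) * (\<integral>\<omega>. f j (X \<omega>) * ?I Y j \<omega> \<partial>M) + \<beta> * (\<integral>\<omega>. f j (X \<omega>) \<partial>M)" for j
  proof -
    \<comment> \<open>There are finitely many classes, so their exceptional null sets merge into one
      and the quantifier moves inside \<open>AE\<close>.\<close>
    have "AE \<omega> in M. \<forall>c. Y \<omega> = one_hot c \<longrightarrow>
        real_cond_exp M G (?I Yn j) \<omega> = (if j = c then 1 - \<eta> else \<beta>)"
      using noise unfolding symmetric_label_noise_def G_def \<beta>_def AE_all_countable by blast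
    \<comment> \<open>Both cases of the noise model in one formula: the value is
      \<open>\<beta>\<close> everywhere, plus the excess \<open>1 - \<eta> - \<beta>\<close> where
      the true label is \<open>j\<close>.\<close>
    then have AE: "AE \<omega> in M. real_cond_exp M G (?I Yn j) \<omega> = (1 - \<eta> - \<beta>) * ?I Y j \<omega> + \<beta>"
    proof (rule AE_mp, intro AE_I2 impI)
      fix \<omega> assume \<omega>: "\<omega> \<in> space M" and
        ce: "\<forall>c. Y \<omega> = one_hot c \<longrightarrow>
          real_cond_exp M G (?I Yn j) \<omega> = (if j = c then 1 - \<eta> else \<beta>)"
      obtain c where "Y \<omega> = one_hot c" using Y \<omega> by (auto simp: random_label_def)
      then show "real_cond_exp M G (?I Yn j) \<omega> = (1 - \<eta> - \<beta>) * ?I Y j \<omega> + \<beta>"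
        using ce \<omega> by (auto simp: one_hot_eq_iff indicator_def)
    qed
    \<comment> \<open>Defining property of conditional expectation, tested against the
      \<open>G\<close>-measurable factor \<open>f j (X \<omega>)\<close>.\<close>
    have "(\<integral>\<omega>. f j (X \<omega>) * ?I Yn j \<omega> \<partial>M)
        = (\<integral>\<omega>. f j (X \<omega>) * real_cond_exp M G (?I Yn j) \<omega> \<partial>M)"
      using measurable_compose[OF XG f] intI by (intro real_cond_exp_intg(2)[symmetric]) auto
    also have "\<dots> = (\<integral>\<omega>. f j (X \<omega>) * ((1 - \<eta> - \<beta>) * ?I Y j \<omega> + \<beta>) \<partial>M)"
      using AE by (intro integral_cong_AE) auto
    also have "\<dots> = (\<integral>\<omega>. (1 - \<eta> - \<beta>) * (f j (X \<omega>) * ?I Y j \<omega>) + \<beta> * f j (X \<omega>) \<partial>M)"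
      by (rule arg_cong[where f = "integral\<^sup>L M"]) (auto simp: algebra_simps)
    also have "\<dots> = (1 - \<eta> - \<beta>) * (\<integral>\<omega>. f j (X \<omega>) * ?I Y j \<omega> \<partial>M) + \<beta> * (\<integral>\<omega>. f j (X \<omega>) \<partial>M)"
      using intI by simp
    finally show ?thesis .
  qed
  \<comment> \<open>Only after summation over \<open>j\<close> does the \<open>\<beta>\<close> part
    of \<open>noisy_term\<close> become a constant: the losses at all labels add up to
    \<open>C\<close>, and \<open>M\<close> has total mass 1.\<close>
  have "(\<Sum>j\<in>UNIV. \<integral>\<omega>. f j (X \<omega>) \<partial>M) = (\<integral>\<omega>. (\<Sum>j\<in>UNIV. f j (X \<omega>)) \<partial>M)"
    using intI by (intro Bochner_Integration.integral_sum[symmetric]) auto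
  also have "\<dots> = (\<integral>\<omega>. C \<partial>M)"
    using const measurable_space[OF X] by (intro Bochner_Integration.integral_cong) auto
  finally have "(\<Sum>j\<in>UNIV. \<integral>\<omega>. f j (X \<omega>) \<partial>M) = C" by (simp add: prob_space)
  then show ?thesis
    by (simp only: Bochner_Integration.integral_sum[OF intI(1)]
      Bochner_Integration.integral_sum[OF intI(2)] noisy_term sum.distrib sum_distrib_left[symmetric])
qed

text \<open>Exactly one indicator is nonzero at each point, as a label is one-hot for a unique
  class. The label thus enters only through indicators, the form to which the noise model
  applies.\<close>

lemma risk_eq_sum_indicator:
  fixes Y :: "'w \<Rightarrow> real ^ 'z::finite"
  assumes X: "X \<in> measurable M N" and Y: "random_label M Y"
    and L: "\<And>x j. x \<in> space N \<Longrightarrow> L (F x) (one_hot j) = f j x"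
  shows "risk M L X Y F
    = (\<integral>\<omega>. (\<Sum>j\<in>UNIV. f j (X \<omega>) * indicator {\<omega> \<in> space M. Y \<omega> = one_hot j} \<omega>) \<partial>M)"
  unfolding risk_def
proof (rule Bochner_Integration.integral_cong[OF refl])
  fix \<omega> assume \<omega>: "\<omega> \<in> space M"
  then obtain c where "Y \<omega> = one_hot c" using Y by (auto simp: random_label_def)
  then show "L (F (X \<omega>)) (Y \<omega>)
      = (\<Sum>j\<in>UNIV. f j (X \<omega>) * indicator {\<omega> \<in> space M. Y \<omega> = one_hot j} \<omega>)"
    using L[OF measurable_space[OF X \<omega>]] \<omega> by (simp add: indicator_def one_hot_eq_iff)
qed

text \<open>This puts both losses into one form, with slopes \<open>1 / x1\<^sup>2\<close> and
  \<open>exp x2\<close>, so that the rest of the argument need not distinguish them.\<close>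

lemma affine_above_threshold:
  assumes "x1 < 0" and "(l = nfl_loss x1 \<and> t = x1) \<or> (l = el_loss x2 \<and> t = x2)"
  obtains a b where "0 < a" and "\<And>x. t < x \<Longrightarrow> l x = a * x + b"
  using assms(2)
proof (elim disjE conjE)
  assume "l = nfl_loss x1" "t = x1"
  then show thesis using \<open>x1 < 0\<close> by (intro that[of "1 / x1\<^sup>2" "- 1 / x1"]) (auto simp: nfl_loss_def)
next
  assume "l = el_loss x2" "t = x2"
  then show thesis
    by (intro that[of "exp x2" "exp x2 * (1 - x2)"]) (auto simp: el_loss_def algebra_simps)
qed

theorem theorem1:
  fixes M :: "'w measure" and N :: "'a measure"
    and X :: "'w \<Rightarrow> 'a" and Y Yn :: "'w \<Rightarrow> real ^ 'z::finite"
    and \<eta> x1 x2 t :: real and l :: "real \<Rightarrow> real"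
    and \<F> :: "('a \<Rightarrow> real ^ 'z) set"
  assumes "CARD('z) \<ge> 2"
    and "prob_space M"
    and "X \<in> measurable M N"
    and "random_label M Y"
    and "random_label M Yn"
    and "0 \<le> \<eta>" and "\<eta> \<le> 1"
    and "\<eta> < (real CARD('z) - 1) / real CARD('z)"
    and "symmetric_label_noise M N \<eta> X Y Yn"
    and "x1 < 0"
    and "(l = nfl_loss x1 \<and> t = x1) \<or> (l = el_loss x2 \<and> t = x2)"
    and "\<And>F. F \<in> \<F> \<Longrightarrow> softmax_classifier N F"
    and "\<And>F x j. F \<in> \<F> \<Longrightarrow> x \<in> space N \<Longrightarrow> l1_norm (one_hot j - F x) > t"
  shows "noise_tolerant M X Y Yn \<F> (residual_loss l)"
proof -
  obtain a b where "0 < a" and affine: "\<And>x. t < x \<Longrightarrow> l x = a * x + b"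
    using affine_above_threshold assms(10,11) by metis
  define Z where "Z = real CARD('z)"
  define \<beta> where "\<beta> = \<eta> / (Z - 1)"
  \<comment> \<open>The sum over the \<open>Z\<close> classes of
    \<open>a * (2 - 2 * u $ j) + b\<close>, given that the entries of \<open>u\<close> add up to
    1.\<close>
  define C where "C = a * (2 * Z - 2) + Z * b"
  have "Z \<ge> 2" using assms(1) by (simp add: Z_def)
  \<comment> \<open>The left factor equals \<open>1 - \<eta> * Z / (Z - 1)\<close>, so for
    \<open>Z > 1\<close> positivity is precisely \<open>\<eta> < (Z - 1) / Z\<close>.\<close>
  then have "0 < 1 - \<eta> - \<beta>"
    using assms(8) by (simp add: \<beta>_def Z_def[symmetric] field_simps)
  moreover have "risk M (residual_loss l) X Yn F
      = (1 - \<eta> - \<beta>) * risk M (residual_loss l) X Y F + \<beta> * C" if F: "F \<in> \<F>" for F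
  proof -
    \<comment> \<open>The affine formula stands in for the loss, with which it agrees on
      \<open>space N\<close>; its measurability then comes directly from that of
      \<open>F\<close>.\<close>
    define f where "f j x = a * (2 - 2 * F x $ j) + b" for j x
    have [measurable]: "F \<in> borel_measurable N"
      using assms(12)[OF F] by (simp add: softmax_classifier_def)
    have nn: "0 \<le> F x $ j" and sum1: "(\<Sum>i\<in>UNIV. F x $ i) = 1" if "x \<in> space N" for x j
      using assms(12)[OF F] that by (auto simp: softmax_classifier_def softmax_nonneg sum_softmax)
    have le1: "F x $ j \<le> 1" if "x \<in> space N" for x j
      using member_le_sum[of j UNIV "\<lambda>i. F x $ i"] nn[OF that] sum1[OF that] by simp
    have loss: "residual_loss l (F x) (one_hot j) = f j x" if "x \<in> space N" for x j
      using affine[OF assms(13)[OF F that]] l1_norm_one_hot_diff[OF nn sum1, OF that that]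
      by (simp add: residual_loss_def f_def)
    have meas: "f j \<in> borel_measurable N" for j
    proof -
      have "(\<lambda>x. F x $ j) \<in> borel_measurable N"
        by (rule borel_measurable_continuous_on[where f = "\<lambda>v. v $ j"]) (auto intro: continuous_intros)
      then show ?thesis unfolding f_def by measurable
    qed
    \<comment> \<open>Entries of \<open>F x\<close> lie between 0 and 1, so the part with slope
      \<open>a\<close> lies between 0 and \<open>2 * a\<close>.\<close>
    have bound: "\<bar>f j x\<bar> \<le> 2 * a + \<bar>b\<bar>" if "x \<in> space N" for j x
    proof -
      have "0 \<le> a * (2 - 2 * F x $ j)" "a * (2 - 2 * F x $ j) \<le> a * 2"
        using \<open>0 < a\<close> le1[OF that, of j] nn[OF that, of j] by (auto intro!: mult_left_mono mult_nonneg_nonneg)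
      then show ?thesis unfolding f_def by linarith
    qed
    have const: "(\<Sum>j\<in>UNIV. f j x) = C" if "x \<in> space N" for x
      using sum1[OF that]
      by (simp add: f_def C_def Z_def sum.distrib sum_subtractf algebra_simps flip: sum_distrib_left)
    have risk: "risk M (residual_loss l) X Y' F
        = (\<integral>\<omega>. (\<Sum>j\<in>UNIV. f j (X \<omega>) * indicator {\<omega> \<in> space M. Y' \<omega> = one_hot j} \<omega>) \<partial>M)"
      if "random_label M Y'" for Y'
      by (rule risk_eq_sum_indicator[where L = "residual_loss l" and F = F and f = f, OF assms(3) that loss])
    show ?thesis
      unfolding risk[OF assms(4)] risk[OF assms(5)] \<beta>_def Z_def
      by (rule expectation_symmetric_label_noise[OF assms(2-5) assms(9) meas bound const])
  qed
  ultimately show ?thesis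
    unfolding noise_tolerant_def by (rule minimizers_affine)
qed

end
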